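(* Let $\mathbf R=(R,\oplus,\cdot,0,1)$ be a ring-like structure of events (RLSE), and write $x':=x\oplus1$. Then $\mathbf R$ is a Boolean ring (with addition $\oplus$ and multiplication $\cdot$) if and only if $\mathbf R$ is weakly associative, i.e. satisfies $(x\oplus y)\oplus1=x\oplus(y\oplus1)$ for all $x,y$, and satisfies the identity $(xy'\oplus1)(x'y\oplus1)\oplus1= x\oplus y$ for all $x,y\in R$.
   Context: A ring-like structure of events (RLSE) is an algebra $(R,\oplus,\cdot,0,1)$ of type $(2,2,0,0)$ such that $(R,\cdot,1)$ is an idempotent commutative monoid with zero element $0$ (i.e. $x0=0$ for all $x$), satisfying the identities (R1) $x\oplus y= y\oplus x$; (R2) $(xy\oplus1)(x\oplus1)\oplus1= x$; (R3) $((xy\oplus1)x\oplus1)x= xy$; (R4) $xy\oplus(x\oplus1)=(xy\oplus1)x\oplus1$. *)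

theory Defs
  imports "HOL-Algebra.Ring"
begin

text \<open>An algebra of type \<open>(2,2,0,0)\<close> is a record of type \<^typ>\<open>'a ring\<close>; only its signature is
  used, no ring axioms are implied. All identities are relativised to the carrier.\<close>

locale rlse = comm_monoid R for R (structure) +
  assumes add_closed: "\<lbrakk>x \<in> carrier R; y \<in> carrier R\<rbrakk> \<Longrightarrow> x \<oplus> y \<in> carrier R"
    and zero_closed: "\<zero> \<in> carrier R"
    and mult_idem: "x \<in> carrier R \<Longrightarrow> x \<otimes> x = x"
    and mult_zero: "x \<in> carrier R \<Longrightarrow> x \<otimes> \<zero> = \<zero>"
    and R1: "\<lbrakk>x \<in> carrier R; y \<in> carrier R\<rbrakk> \<Longrightarrow> x \<oplus> y = y \<oplus> x"
    and R2: "\<lbrakk>x \<in> carrier R; y \<in> carrier R\<rbrakk> \<Longrightarrow>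
      (x \<otimes> y \<oplus> \<one>) \<otimes> (x \<oplus> \<one>) \<oplus> \<one> = x"
    and R3: "\<lbrakk>x \<in> carrier R; y \<in> carrier R\<rbrakk> \<Longrightarrow>
      ((x \<otimes> y \<oplus> \<one>) \<otimes> x \<oplus> \<one>) \<otimes> x = x \<otimes> y"
    and R4: "\<lbrakk>x \<in> carrier R; y \<in> carrier R\<rbrakk> \<Longrightarrow>
      x \<otimes> y \<oplus> (x \<oplus> \<one>) = (x \<otimes> y \<oplus> \<one>) \<otimes> x \<oplus> \<one>"

locale boolean_ring = ring R for R (structure) +
  assumes mult_idem: "x \<in> carrier R \<Longrightarrow> x \<otimes> x = x"

definition rlse_compl :: "('a, 'b) ring_scheme \<Rightarrow> 'a \<Rightarrow> 'a" where
  "rlse_compl R x = x \<oplus>\<^bsub>R\<^esub> \<one>\<^bsub>R\<^esub>"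

definition weakly_associative :: "('a, 'b) ring_scheme \<Rightarrow> bool" where
  "weakly_associative R \<longleftrightarrow> (\<forall>x\<in>carrier R. \<forall>y\<in>carrier R.
     (x \<oplus>\<^bsub>R\<^esub> y) \<oplus>\<^bsub>R\<^esub> \<one>\<^bsub>R\<^esub> = x \<oplus>\<^bsub>R\<^esub> (y \<oplus>\<^bsub>R\<^esub> \<one>\<^bsub>R\<^esub>))"

end

theory Submission
  imports Defs
begin

text \<open>
  An RLSE is an orthomodular lattice with meet \<open>xy\<close> and orthocomplement \<open>x' = x \<oplus> 1\<close>, in which
  an element commuting with \<open>y\<close> and \<open>z\<close> distributes over \<open>y \<or> z\<close> (Foulis and Holland).
  If \<open>x \<oplus> y = xy' \<or> x'y\<close>, then below \<open>x\<close> the elements \<open>(x \<oplus> y)'\<close> and \<open>(x \<oplus> y')'\<close> coincide with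
  \<open>(xy')'\<close> and \<open>(xy)'\<close>. Weak associativity makes the former two complementary, so that
  \<open>x(xy)'(xy')' = 0\<close>, which by orthomodularity means \<open>x = xy \<or> xy'\<close>: any two elements
  commute. Hence the lattice is Boolean and \<open>\<oplus>\<close> is its symmetric difference.
\<close>

context rlse
begin

declare add_closed [simp, intro] zero_closed [simp, intro]

abbreviation compl :: "'a \<Rightarrow> 'a" (\<open>\<sim> _\<close> [81] 80)
  where "\<sim> x \<equiv> rlse_compl R x"

abbreviation below :: "'a \<Rightarrow> 'a \<Rightarrow> bool" (infix \<open>\<preceq>\<close> 50)
  where "x \<preceq> y \<equiv> x \<otimes> y = x"

definition join :: "'a \<Rightarrow> 'a \<Rightarrow> 'a" (infixl \<open>\<curlyvee>\<close> 65)
  where "x \<curlyvee> y = \<sim> (\<sim> x \<otimes> \<sim> y)"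

definition commutes :: "'a \<Rightarrow> 'a \<Rightarrow> bool"
  where "commutes x y \<longleftrightarrow> x \<otimes> y \<curlyvee> x \<otimes> \<sim> y = x"

lemma compl_closed [simp, intro]: "x \<in> carrier R \<Longrightarrow> \<sim> x \<in> carrier R"
  by (simp add: rlse_compl_def)

lemma join_closed [simp, intro]: "\<lbrakk>x \<in> carrier R; y \<in> carrier R\<rbrakk> \<Longrightarrow> x \<curlyvee> y \<in> carrier R"
  by (simp add: join_def)

lemma mult_idem_left:
  assumes "x \<in> carrier R" "y \<in> carrier R"
  shows "x \<otimes> (x \<otimes> y) = x \<otimes> y"
  using assms by (simp add: m_assoc[symmetric] mult_idem)

lemma mult_below_left: "\<lbrakk>x \<in> carrier R; y \<in> carrier R\<rbrakk> \<Longrightarrow> x \<otimes> y \<preceq> x"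
  by (simp add: m_ac mult_idem_left)

lemma zero_mult: "x \<in> carrier R \<Longrightarrow> \<zero> \<otimes> x = \<zero>"
  by (simp add: m_comm[of \<zero>] mult_zero)

lemma compl_compl: "x \<in> carrier R \<Longrightarrow> \<sim> (\<sim> x) = x"
  using R2[of x \<one>] by (simp add: rlse_compl_def mult_idem)

lemma compl_below_compl_mult:
  assumes "x \<in> carrier R" "y \<in> carrier R"
  shows "\<sim> x \<preceq> \<sim> (x \<otimes> y)"
proof -
  have "\<sim> (\<sim> (x \<otimes> y) \<otimes> \<sim> x) = x"
    using R2[OF assms] by (simp add: rlse_compl_def)
  then have "\<sim> (x \<otimes> y) \<otimes> \<sim> x = \<sim> x"
    using compl_compl[of "\<sim> (x \<otimes> y) \<otimes> \<sim> x"] assms by simp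
  then show ?thesis
    using assms by (simp add: m_comm)
qed

lemma compl_antimono:
  assumes "x \<in> carrier R" "y \<in> carrier R" "x \<preceq> y"
  shows "\<sim> y \<preceq> \<sim> x"
  using compl_below_compl_mult[of y x] assms by (simp add: m_comm)

lemma orthomodular:
  assumes "x \<in> carrier R" "y \<in> carrier R"
  shows "x \<otimes> \<sim> (x \<otimes> \<sim> (x \<otimes> y)) = x \<otimes> y"
  using R3[OF assms] assms by (simp add: rlse_compl_def m_comm)

lemma compl_zero: "\<sim> \<zero> = \<one>"
  using compl_below_compl_mult[of "\<sim> \<one>" \<zero>]
  by (simp add: compl_compl mult_zero)

lemma compl_one: "\<sim> \<one> = \<zero>"
  using compl_compl[of \<zero>] by (simp add: compl_zero)

lemma mult_compl: "x \<in> carrier R \<Longrightarrow> x \<otimes> \<sim> x = \<zero>"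
  using orthomodular[of x \<zero>] by (simp add: compl_zero mult_zero)

lemma orthomodular_eqI:
  assumes "x \<in> carrier R" "y \<in> carrier R" "x \<preceq> y" "y \<otimes> \<sim> x = \<zero>"
  shows "x = y"
  using orthomodular[of y x] assms by (simp add: m_comm[of y x] compl_zero)

lemma compl_join: "\<lbrakk>x \<in> carrier R; y \<in> carrier R\<rbrakk> \<Longrightarrow> \<sim> (x \<curlyvee> y) = \<sim> x \<otimes> \<sim> y"
  by (simp add: join_def compl_compl)

lemma below_join_left:
  assumes "x \<in> carrier R" "y \<in> carrier R"
  shows "x \<preceq> x \<curlyvee> y"
  using compl_below_compl_mult[of "\<sim> x" "\<sim> y"] assms by (simp add: join_def compl_compl)

lemma below_join_right:
  assumes "x \<in> carrier R" "y \<in> carrier R"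
  shows "y \<preceq> x \<curlyvee> y"
  using below_join_left[of y x] assms by (simp add: join_def m_comm)

lemma join_least:
  assumes x: "x \<in> carrier R" and y: "y \<in> carrier R" and z: "z \<in> carrier R"
    and "x \<preceq> z" "y \<preceq> z"
  shows "x \<curlyvee> y \<preceq> z"
proof -
  have "\<sim> z \<otimes> (\<sim> x \<otimes> \<sim> y) = (\<sim> z \<otimes> \<sim> x) \<otimes> \<sim> y"
    using x y z by (simp add: m_assoc)
  also have "\<dots> = \<sim> z"
    using assms by (simp add: compl_antimono)
  finally have "\<sim> (\<sim> x \<otimes> \<sim> y) \<preceq> \<sim> (\<sim> z)"
    using x y z by (simp add: compl_antimono)
  then show ?thesis
    using z by (simp add: join_def compl_compl)
qed

lemma commutesI:
  assumes x: "x \<in> carrier R" and y: "y \<in> carrier R"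
    and "x \<otimes> (\<sim> (x \<otimes> y) \<otimes> \<sim> (x \<otimes> \<sim> y)) = \<zero>"
  shows "commutes x y"
  unfolding commutes_def
proof (rule orthomodular_eqI)
  show "x \<otimes> y \<curlyvee> x \<otimes> \<sim> y \<preceq> x"
    using x y by (intro join_least mult_below_left) auto
  show "x \<otimes> \<sim> (x \<otimes> y \<curlyvee> x \<otimes> \<sim> y) = \<zero>"
    using assms by (simp add: compl_join)
qed (use x y in auto)

lemma mult_compl_mult:
  assumes x: "x \<in> carrier R" and y: "y \<in> carrier R" and "commutes x y"
  shows "x \<otimes> \<sim> (x \<otimes> y) = x \<otimes> \<sim> y"
proof (rule orthomodular_eqI[symmetric])
  have "\<sim> y \<preceq> \<sim> (x \<otimes> y)"
    using compl_below_compl_mult[of y x] x y by (simp add: m_comm)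
  then show "x \<otimes> \<sim> y \<preceq> x \<otimes> \<sim> (x \<otimes> y)"
    using x y by (simp add: m_ac mult_idem_left)
  have "(x \<otimes> \<sim> (x \<otimes> y)) \<otimes> \<sim> (x \<otimes> \<sim> y) = x \<otimes> \<sim> (x \<otimes> y \<curlyvee> x \<otimes> \<sim> y)"
    using x y by (simp add: compl_join m_assoc)
  also have "\<dots> = \<zero>"
    using \<open>commutes x y\<close> x by (simp add: commutes_def mult_compl)
  finally show "(x \<otimes> \<sim> (x \<otimes> y)) \<otimes> \<sim> (x \<otimes> \<sim> y) = \<zero>" .
qed (use x y in auto)

lemma mult_join_distrib:
  assumes x: "x \<in> carrier R" and y: "y \<in> carrier R" and z: "z \<in> carrier R"
    and "commutes x y" "commutes x z"
  shows "x \<otimes> (y \<curlyvee> z) = x \<otimes> y \<curlyvee> x \<otimes> z"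
proof (rule orthomodular_eqI[symmetric])
  have "x \<otimes> y \<preceq> x \<otimes> (y \<curlyvee> z)" "x \<otimes> z \<preceq> x \<otimes> (y \<curlyvee> z)"
    using x y z below_join_left[OF y z] below_join_right[OF y z]
    by (simp_all add: m_ac mult_idem_left)
  then show "x \<otimes> y \<curlyvee> x \<otimes> z \<preceq> x \<otimes> (y \<curlyvee> z)"
    using x y z by (simp add: join_least)
  have "x \<otimes> (y \<curlyvee> z) \<otimes> \<sim> (x \<otimes> y \<curlyvee> x \<otimes> z)
      = (y \<curlyvee> z) \<otimes> ((x \<otimes> \<sim> (x \<otimes> y)) \<otimes> (x \<otimes> \<sim> (x \<otimes> z)))"
    using x y z by (simp add: compl_join m_ac mult_idem_left)
  also have "\<dots> = (y \<curlyvee> z) \<otimes> ((x \<otimes> \<sim> y) \<otimes> (x \<otimes> \<sim> z))"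
    using assms by (simp add: mult_compl_mult)
  also have "\<dots> = x \<otimes> ((y \<curlyvee> z) \<otimes> \<sim> (y \<curlyvee> z))"
    using x y z by (simp add: compl_join m_ac mult_idem_left)
  also have "\<dots> = \<zero>"
    using x y z by (simp add: mult_compl mult_zero)
  finally show "x \<otimes> (y \<curlyvee> z) \<otimes> \<sim> (x \<otimes> y \<curlyvee> x \<otimes> z) = \<zero>" .
qed (use x y z in auto)

lemma eq_if_mult_eq_compl_mult_eq:
  assumes "x \<in> carrier R" "y \<in> carrier R" "z \<in> carrier R"
    and "commutes x z" "commutes y z"
    and "z \<otimes> x = z \<otimes> y" "\<sim> z \<otimes> x = \<sim> z \<otimes> y"
  shows "x = y"
proof -
  have "x = z \<otimes> x \<curlyvee> \<sim> z \<otimes> x" "y = z \<otimes> y \<curlyvee> \<sim> z \<otimes> y"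
    using assms(1-5) by (simp_all add: commutes_def m_comm)
  then show ?thesis
    using assms(6,7) by metis
qed

end

locale xor_rlse = rlse +
  assumes add_eq_join: "\<lbrakk>x \<in> carrier R; y \<in> carrier R\<rbrakk> \<Longrightarrow> x \<oplus> y = x \<otimes> \<sim> y \<curlyvee> \<sim> x \<otimes> y"
begin

lemma zero_add: "x \<in> carrier R \<Longrightarrow> \<zero> \<oplus> x = x"
  by (simp add: add_eq_join join_def compl_zero compl_compl zero_mult)

lemma add_self: "x \<in> carrier R \<Longrightarrow> x \<oplus> x = \<zero>"
  by (simp add: add_eq_join join_def m_comm[of "\<sim> x"] mult_compl compl_zero compl_one)

lemma mult_compl_add:
  assumes x: "x \<in> carrier R" and y: "y \<in> carrier R"
  shows "x \<otimes> \<sim> (x \<oplus> y) = x \<otimes> \<sim> (x \<otimes> \<sim> y)"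
proof -
  have "x \<preceq> \<sim> (\<sim> x \<otimes> y)"
    using compl_below_compl_mult[of "\<sim> x" y] x y by (simp add: compl_compl)
  then show ?thesis
    using x y by (simp add: add_eq_join compl_join m_lcomm[of x] m_comm)
qed

lemma commutes_if_compl_add:
  assumes x: "x \<in> carrier R" and y: "y \<in> carrier R" and compl_add: "\<sim> (x \<oplus> y) = x \<oplus> \<sim> y"
  shows "commutes x y"
proof (rule commutesI)
  have "x \<otimes> (\<sim> (x \<otimes> y) \<otimes> \<sim> (x \<otimes> \<sim> y))
      = (x \<otimes> \<sim> (x \<otimes> \<sim> (\<sim> y))) \<otimes> (x \<otimes> \<sim> (x \<otimes> \<sim> y))"
    using x y by (simp add: compl_compl m_ac mult_idem_left)
  also have "\<dots> = (x \<otimes> \<sim> (x \<oplus> \<sim> y)) \<otimes> (x \<otimes> \<sim> (x \<oplus> y))"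
    using x y by (simp only: mult_compl_add compl_closed)
  also have "\<dots> = x \<otimes> ((x \<oplus> y) \<otimes> \<sim> (x \<oplus> y))"
    using x y by (simp add: compl_add[symmetric] compl_compl m_ac mult_idem_left)
  also have "\<dots> = \<zero>"
    using x y by (simp add: mult_compl mult_zero)
  finally show "x \<otimes> (\<sim> (x \<otimes> y) \<otimes> \<sim> (x \<otimes> \<sim> y)) = \<zero>" .
qed (use x y in auto)

end

locale weakly_associative_xor_rlse = xor_rlse +
  assumes compl_add: "\<lbrakk>x \<in> carrier R; y \<in> carrier R\<rbrakk> \<Longrightarrow> \<sim> (x \<oplus> y) = x \<oplus> \<sim> y"
begin

lemma all_commute: "\<lbrakk>x \<in> carrier R; y \<in> carrier R\<rbrakk> \<Longrightarrow> commutes x y"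
  by (simp add: commutes_if_compl_add compl_add)

lemma mult_add_distrib:
  assumes x: "x \<in> carrier R" and y: "y \<in> carrier R" and z: "z \<in> carrier R"
  shows "x \<otimes> (y \<oplus> z) = x \<otimes> y \<oplus> x \<otimes> z"
proof -
  have "x \<otimes> (y \<otimes> \<sim> z) = y \<otimes> (x \<otimes> \<sim> (x \<otimes> z))"
    using x y z by (simp add: mult_compl_mult all_commute m_lcomm)
  also have "\<dots> = (x \<otimes> y) \<otimes> \<sim> (x \<otimes> z)"
    using x y z by (simp add: m_ac)
  finally have "x \<otimes> (y \<otimes> \<sim> z) = (x \<otimes> y) \<otimes> \<sim> (x \<otimes> z)" .
  moreover have "x \<otimes> (\<sim> y \<otimes> z) = (x \<otimes> \<sim> (x \<otimes> y)) \<otimes> z"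
    using x y z by (simp add: mult_compl_mult all_commute m_assoc)
  then have "x \<otimes> (\<sim> y \<otimes> z) = \<sim> (x \<otimes> y) \<otimes> (x \<otimes> z)"
    using x y z by (simp add: m_ac)
  ultimately show ?thesis
    using x y z by (simp add: add_eq_join mult_join_distrib all_commute)
qed

lemma mult_add_self:
  assumes "x \<in> carrier R" "y \<in> carrier R"
  shows "x \<otimes> (x \<oplus> y) = x \<otimes> \<sim> y"
proof -
  have "x \<otimes> (x \<oplus> y) = x \<otimes> \<one> \<oplus> x \<otimes> y"
    using assms by (simp add: mult_add_distrib mult_idem)
  also have "\<dots> = x \<otimes> \<sim> y"
    using assms mult_add_distrib[of x \<one> y] by (simp add: rlse_compl_def R1)
  finally show ?thesis .
qed

lemma compl_mult_add_self:
  assumes "x \<in> carrier R" "y \<in> carrier R"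
  shows "\<sim> x \<otimes> (x \<oplus> y) = \<sim> x \<otimes> y"
  using assms by (simp add: mult_add_distrib m_comm[of "\<sim> x" x] mult_compl zero_add)

lemma add_assoc:
  assumes x: "x \<in> carrier R" and y: "y \<in> carrier R" and z: "z \<in> carrier R"
  shows "(x \<oplus> y) \<oplus> z = x \<oplus> (y \<oplus> z)"
proof (rule eq_if_mult_eq_compl_mult_eq[of _ _ x])
  have "x \<otimes> ((x \<oplus> y) \<oplus> z) = x \<otimes> (\<sim> y \<oplus> z)"
    using x y z by (simp add: mult_add_distrib[of x _ z] mult_add_self)
  also have "\<sim> y \<oplus> z = \<sim> (y \<oplus> z)"
    using compl_add[of z y] y z by (simp add: R1)
  also have "x \<otimes> \<dots> = x \<otimes> (x \<oplus> (y \<oplus> z))"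
    using x y z by (simp add: mult_add_self)
  finally show "x \<otimes> ((x \<oplus> y) \<oplus> z) = x \<otimes> (x \<oplus> (y \<oplus> z))" .
  have "\<sim> x \<otimes> ((x \<oplus> y) \<oplus> z) = \<sim> x \<otimes> (y \<oplus> z)"
    using x y z by (simp add: mult_add_distrib[of "\<sim> x" _ z] compl_mult_add_self)
  also have "\<dots> = \<sim> x \<otimes> (x \<oplus> (y \<oplus> z))"
    using x y z by (simp add: compl_mult_add_self)
  finally show "\<sim> x \<otimes> ((x \<oplus> y) \<oplus> z) = \<sim> x \<otimes> (x \<oplus> (y \<oplus> z))" .
qed (use x y z in \<open>auto intro: all_commute\<close>)

lemma is_boolean_ring: "boolean_ring R"
proof -
  have "abelian_group R"
    by (rule abelian_groupI) (auto intro: add_assoc R1 zero_add add_self)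
  moreover have "(x \<oplus> y) \<otimes> z = x \<otimes> z \<oplus> y \<otimes> z"
    if "x \<in> carrier R" "y \<in> carrier R" "z \<in> carrier R" for x y z
    using that mult_add_distrib[of z x y] by (simp add: m_comm)
  ultimately have "ring R"
    by (intro ringI) (auto intro: monoid_axioms mult_add_distrib)
  then show ?thesis
    by (intro boolean_ring.intro boolean_ring_axioms.intro mult_idem)
qed

end

context boolean_ring
begin

lemma add_self:
  assumes x: "x \<in> carrier R"
  shows "x \<oplus> x = \<zero>"
proof -
  have "x \<oplus> x = (x \<oplus> x) \<otimes> (x \<oplus> x)"
    using x by (simp add: mult_idem)
  also have "\<dots> = (x \<oplus> x) \<oplus> (x \<oplus> x)"
    using x by (subst l_distr) (simp_all add: r_distr mult_idem)
  finally show ?thesis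
    using x by simp
qed

lemma add_self_left: "\<lbrakk>x \<in> carrier R; y \<in> carrier R\<rbrakk> \<Longrightarrow> x \<oplus> (x \<oplus> y) = y"
  by (simp add: a_assoc[symmetric] add_self)

lemma mult_commute:
  assumes x: "x \<in> carrier R" and y: "y \<in> carrier R"
  shows "x \<otimes> y = y \<otimes> x"
proof -
  have "x \<oplus> y = (x \<oplus> y) \<otimes> (x \<oplus> y)"
    using x y by (simp add: mult_idem)
  also have "\<dots> = x \<otimes> (x \<oplus> y) \<oplus> y \<otimes> (x \<oplus> y)"
    using x y by (simp add: l_distr)
  also have "\<dots> = (x \<oplus> y) \<oplus> (x \<otimes> y \<oplus> y \<otimes> x)"
    using x y by (simp add: r_distr mult_idem a_ac)
  finally have "x \<otimes> y \<oplus> y \<otimes> x = \<zero>"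
    using x y add.l_cancel_one'[of "x \<oplus> y"] by simp
  then show ?thesis
    using x y add_self_left[of "x \<otimes> y" "y \<otimes> x"] by simp
qed

lemma mult_add_one: "x \<in> carrier R \<Longrightarrow> x \<otimes> (x \<oplus> \<one>) = \<zero>"
  by (simp add: r_distr mult_idem add_self)

lemma de_morgan_orthogonal:
  assumes "x \<in> carrier R" "y \<in> carrier R" "x \<otimes> y = \<zero>"
  shows "(x \<oplus> \<one>) \<otimes> (y \<oplus> \<one>) \<oplus> \<one> = x \<oplus> y"
  using assms by (simp add: l_distr r_distr a_ac add_self)

lemma add_eq_compl_mult_compl:
  assumes x: "x \<in> carrier R" and y: "y \<in> carrier R"
  shows "(x \<otimes> (y \<oplus> \<one>) \<oplus> \<one>) \<otimes> ((x \<oplus> \<one>) \<otimes> y \<oplus> \<one>) \<oplus> \<one> = x \<oplus> y"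
proof -
  have "(x \<otimes> (y \<oplus> \<one>)) \<otimes> ((x \<oplus> \<one>) \<otimes> y) = x \<otimes> ((y \<oplus> \<one>) \<otimes> (x \<oplus> \<one>)) \<otimes> y"
    using x y by (simp add: m_assoc)
  also have "\<dots> = x \<otimes> ((x \<oplus> \<one>) \<otimes> (y \<oplus> \<one>)) \<otimes> y"
    using x y by (simp add: mult_commute[of "y \<oplus> \<one>" "x \<oplus> \<one>"])
  also have "\<dots> = (x \<otimes> (x \<oplus> \<one>)) \<otimes> ((y \<oplus> \<one>) \<otimes> y)"
    using x y by (simp add: m_assoc)
  also have "\<dots> = \<zero>"
    using x y by (simp add: mult_add_one)
  finally have "(x \<otimes> (y \<oplus> \<one>) \<oplus> \<one>) \<otimes> ((x \<oplus> \<one>) \<otimes> y \<oplus> \<one>) \<oplus> \<one>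
      = x \<otimes> (y \<oplus> \<one>) \<oplus> (x \<oplus> \<one>) \<otimes> y"
    using x y by (simp add: de_morgan_orthogonal)
  also have "\<dots> = x \<oplus> y"
    using x y by (simp add: l_distr r_distr a_ac add_self add_self_left)
  finally show ?thesis .
qed

end

theorem theorem2p4:
  fixes R :: "('a, 'b) ring_scheme" (structure)
  assumes "rlse R"
  shows "boolean_ring R \<longleftrightarrow>
    weakly_associative R \<and>
    (\<forall>x\<in>carrier R. \<forall>y\<in>carrier R.
       (x \<otimes> rlse_compl R y \<oplus> \<one>) \<otimes> (rlse_compl R x \<otimes> y \<oplus> \<one>) \<oplus> \<one> = x \<oplus> y)"
    (is "_ \<longleftrightarrow> ?W \<and> ?I")
proof
  assume "boolean_ring R"
  then interpret boolean_ring R .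
  have ?W
    by (simp add: weakly_associative_def a_assoc)
  moreover have ?I
    by (simp add: rlse_compl_def add_eq_compl_mult_compl)
  ultimately show "?W \<and> ?I" ..
next
  assume "?W \<and> ?I"
  interpret rlse R by fact
  have "weakly_associative_xor_rlse R"
    using \<open>?W \<and> ?I\<close>
    by unfold_locales (auto simp: weakly_associative_def rlse_compl_def join_def)
  then show "boolean_ring R"
    by (rule weakly_associative_xor_rlse.is_boolean_ring)
qed

end
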